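(* Consider the numerical scheme described in the context, with modelling assumptions (A1)--(A5). Fix a threshold node $w_c\in\Gamma_h$, and let $h>0$ be the global refinement parameter, with the mesh scaling $\Delta s=K_1h$, $\Delta b=K_2h$, $\Delta u=K_3h$, $\Delta w=K_4h$ and the sampling and training assumptions (see context) satisfied. If bilinear interpolation is used in the intervention step, then the scheme is $\ell_\infty$-stable for each fixed $w_c$: there exist constants $h_0>0$ and $0<C<\infty$, independent of $h$, such that for all $0<h\le h_0$ and all $m=0,\dots,M$, $$\|V_c^{m,-}\|_\infty\le C,\qquad\text{where}\quad \|V_c^{m,-}\|_\infty:=\max_{k\in\mathbb N_s^\dagger,\ j\in\mathbb N_b^\dagger}|V_{k,j,c}^{m,-}|.$$
   Context: **Model.** $T>0$, $M\in\mathbb N$, $\Delta t=T/M$, $t_m=m\Delta t$. $g:\mathbb R^2\to[0,\infty)$ is the probability density of a one-step increment $\Delta X$ over $\Delta t$, with characteristic function $G(\eta)=\int_{\mathbb R^2}e^{i\eta\cdot y}g(y)\,dy$; also $G(-ia)=\mathbb E[e^{a\cdot\Delta X}]$ for $a\in\mathbb R^2$ when finite. Assumptions: (A1) the conditional density of the log-state $X_{m+1}^-$ given $X_m^+=x$ is $y\mapsto g(y-x)$ for all $m$, $x$; (A2) $g\in L_1\cap L_\infty(\mathbb R^2)$; (A3) $G$ is available in closed form; (A4) there are $\alpha'\in(0,2]$, $c_0>0$, $R_{\rm tail}\ge0$ with $|G(\eta)|\le\exp(-c_0\Delta t\|\eta\|_2^{\alpha'})$ for $\|\eta\|_2\ge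 R_{\rm tail}$; (A5) $G(-i,0)$, $G(0,-i)$, $G(-i,-i)$ are finite and $G(0,0)=1$. **Domain and data.** $\gamma>0$, $\alpha\in(0,1)$, deterministic inputs $q_m\ge0$, a floor parameter $w_{-\infty}\ll0$, $w_{\max}>0$, $\Gamma=[0,w_{\max}]$. Let $s_{\min}<0<s_{\max}$, $b_{\min}<0<b_{\max}$, and for $z\in\{s,b\}$ put $z_{\min}^\dagger=z_{\min}-\frac12(z_{\max}-z_{\min})$, $z_{\max}^\dagger=z_{\max}+\frac12(z_{\max}-z_{\min})$. $\Omega=[s_{\min}^\dagger,s_{\max}^\dagger]\times[b_{\min}^\dagger,b_{\max}^\dagger]$, $\Omega_{\rm in}=(s_{\min},s_{\max})\times(b_{\min},b_{\max})$, $\Omega_{s_{\max}}=[s_{\max},s_{\max}^\dagger]\times[b_{\min}^\dagger,b_{\max})$, $\Omega_{b_{\max}}=[s_{\min}^\dagger,s_{\max})\times[b_{\max},b_{\max}^\dagger]$, $\Omega_{s_{\max}}^{b_{\max}}=[s_{\max},s_{\max}^\dagger]\times[b_{\max},b_{\max}^\dagger]$, $\Omega_{s_{\min}}^{b_{\min}}$ = the rest of $\Omega$, $\Omega_{\rm out}=\Omega\setminus\Omega_{\rm in}$. For $x\in\Omega_{\rm out}$: $a(x)=(1,0)$ on $\Omega_{s_{\max}}$, $(0,1)$ on $\Omega_{b_{\max}}$, $(1,1)$ on $\Omega_{s_{\max}}^{b_{\max}}$, $(0,0)$ on $\Omega_{s_{\min}}^{b_{\min}}$. $\Phi(x,w)=(e^s+e^b)+\gamma\big(w+\frac1\alpha\min(e^s+e^b-w,0)\big)$,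 $x=(s,b)$. $x^+(x,q,u)=\big(\ln\max\{u(e^s+e^b+q),e^{w_{-\infty}}\},\ \ln\max\{(1-u)(e^s+e^b+q),e^{w_{-\infty}}\}\big)$; all post-intervention states at which functions on $\Omega$ are evaluated are taken to lie in $\Omega$. **Learned kernel.** Fix $\overline\mu,\sigma_{\max}<\infty$, $\sigma_{\min}>0$, $0<\overline\rho<1$. For $N\in\mathbb N$, $\Theta$ is the set of $\theta=\{(\beta_n,\mu_n^s,\mu_n^b,\sigma_n^s,\sigma_n^b,\rho_n)\}_{n=1}^N$ with $\beta_n\ge0$, $\sum_n\beta_n=1$, $|\mu_n^s|,|\mu_n^b|\le\overline\mu$, $\sigma_{\min}\le\sigma_n^s,\sigma_n^b\le\sigma_{\max}$, $|\rho_n|\le\overline\rho$. With $\mu_n=(\mu_n^s,\mu_n^b)$ and $\Sigma_n$ the covariance matrix with standard deviations $\sigma_n^s,\sigma_n^b$ and correlation $\rho_n$, $\widehat g(y;\theta)=\sum_n\beta_n\phi(y;\mu_n,\Sigma_n)$, $\phi(\cdot;\mu,\Sigma)$ the bivariate normal density, with characteristic function $\widehat G(\eta;\theta)=\sum_n\beta_n\exp(i\eta^\top\mu_n-\frac12\eta^\top\Sigma_n\eta)$. Given $D_\eta=[-\eta',\eta']^2$ and nodes $\{\eta_p\}_{p=1}^P\subset D_\eta$, set $R_P(\theta)=\frac1P\sum_p\big(|\mathrm{Re}(G-\widehat G(\cdot;\theta))(\eta_p)|+|\mathrm{Im}(G-\widehat G(\cdot;\theta))(\eta_p)|\big)$,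 $\mathrm{Loss}_P(\theta)=\frac1P\sum_p|G(\eta_p)-\widehat G(\eta_p;\theta)|^2+R_P(\theta)$, and let $\widehat\theta^\star$ minimize $\mathrm{Loss}_P$ over an empirical set $\widehat\Theta\subset\Theta$. Write $\widehat g(\cdot)=\widehat g(\cdot;\widehat\theta^\star)$. **Sampling and training assumptions** (indexed by $h\in(0,1)$; $\eta',P,N,\widehat\theta^\star$ may depend on $h$). Fix $\kappa\in(0,1)$. There are constants $c_1,c_2,c_3,c_P>0$ independent of $h$ such that: $\int_{\mathbb R^2\setminus[-\eta'(h),\eta'(h)]^2}|f|^p\,d\eta\le c_1h^{1+\kappa}$ for $p\in\{1,2\}$, $f\in\{G,\widehat G(\cdot;\widehat\theta^\star)\}$; $\mathrm{Loss}_P(\widehat\theta^\star)\le c_2h^{1+\kappa}$; $R_P(\widehat\theta^\star)\le c_3h^{1+\kappa}$; $P\ge c_Ph^{-2(1+\kappa)}$. The nodes are quasi-uniform: $C_0P^{-1/2}\le\delta_{\min}\le\delta_{\max}\le C_1P^{-1/2}$ with $\delta_{\min}=\min_{p\ne q}\|\eta_p-\eta_q\|_2$, $\delta_{\max}=\max_p\min_{q\ne p}\|\eta_p-\eta_q\|_2$; and $C_1$ and $C'=\sup_{\eta\in D_\eta,\theta\in\Theta}\|\nabla_\eta|G(\eta)-\widehat G(\eta;\theta)|^2\|_2$ are finite and independent of $h$. **Scheme.** For $z\in\{s,b\}$, $N_z$ is even, $\Delta z=(z_{\max}-z_{\min})/N_z$, nodes $s_k=\frac12(s_{\min}^\dagger+s_{\max}^\dagger)+k\Delta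 s$, $b_j=\frac12(b_{\min}^\dagger+b_{\max}^\dagger)+j\Delta b$, $k\in\mathbb N_s^\dagger=\{-N_s,\dots,N_s\}$, $j\in\mathbb N_b^\dagger=\{-N_b,\dots,N_b\}$; this grid is $\Omega^h$, and $\Omega_{\rm in}^h,\Omega_{\rm out}^h$ are its nodes in $\Omega_{\rm in},\Omega_{\rm out}$. $\mathcal Z_h$ and $\Gamma_h$ are uniform grids (including endpoints) of $[0,1]$ and $[0,w_{\max}]$ with spacings $\Delta u,\Delta w$. The mesh constants $K_i>0$ are independent of $h$. For $w_c\in\Gamma_h$: $V^{M,-}_{k,j,c}=\Phi(s_k,b_j,w_c)$; for $m=M-1,\dots,0$: on $\Omega_{\rm out}^h$, $V_{k,j,c}^{m,-}=V_{k,j,c}^{m,+}=G(-i\,a(s_k,b_j))V_{k,j,c}^{m+1,-}$; on $\Omega_{\rm in}^h$, $V_{k,j,c}^{m,+}=\Delta s\Delta b\sum_{l\in\mathbb N_s^\dagger}\sum_{d\in\mathbb N_b^\dagger}\varphi_{l,d}\,\widehat g(s_l-s_k,b_d-b_j)V_{l,d,c}^{m+1,-}$, with $\varphi_{l,d}$ the composite trapezoidal weights ($1$ interior, $\frac12$ edges, $\frac14$ corners of the grid $\Omega^h$), and $V_{k,j,c}^{m,-}=\max_{u\in\mathcal Z_h}\mathcal I[\{V_c^{m,+}\}](x^+((s_k,b_j),q_m,u))$, with $\mathcal I[\cdot]$ bilinear interpolation on $\Omega$ of the nodal values on $\Omega^h$. *)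

theory Defs
  imports "HOL-Probability.Probability"
begin

record model =
  horizon :: real                     (* T *)
  num_steps :: nat                    (* M *)
  dens :: "real^2 \<Rightarrow> real"             (* g *)
  gam :: real                         (* gamma *)
  conf :: real                        (* alpha *)
  cash :: "nat \<Rightarrow> real"                (* q_m *)
  wfloor :: real                      (* w_{-infinity} *)
  wmax :: real
  smin :: real
  smax :: real
  bmin :: real
  bmax :: real

definition time_step :: "model \<Rightarrow> real" where
  "time_step md = horizon md / real (num_steps md)"

definition model_data :: "model \<Rightarrow> bool" where
  "model_data md \<longleftrightarrow>
     0 < horizon md \<and> 1 \<le> num_steps md \<and>
     0 < gam md \<and> 0 < conf md \<and> conf md < 1 \<and>
     (\<forall>m<num_steps md. 0 \<le> cash md m) \<and>
     wfloor md < 0 \<and> 0 < wmax md \<and>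
     smin md < 0 \<and> 0 < smax md \<and> bmin md < 0 \<and> 0 < bmax md"

definition char_fun :: "(real^2 \<Rightarrow> real) \<Rightarrow> real^2 \<Rightarrow> complex" where
  "char_fun f \<eta> = (LINT y|lborel. iexp (\<eta> \<bullet> y) * complex_of_real (f y))"

(* The value G(-ia) = E[exp (a . Delta X)] of the characteristic function at an imaginary argument. *)
definition exp_moment :: "(real^2 \<Rightarrow> real) \<Rightarrow> real^2 \<Rightarrow> real" where
  "exp_moment f a = (LINT y|lborel. exp (a \<bullet> y) * f y)"

(* Finiteness of G(-ia); needed because exp_moment is 0 when the integral diverges. *)
definition exp_moment_finite :: "(real^2 \<Rightarrow> real) \<Rightarrow> real^2 \<Rightarrow> bool" where
  "exp_moment_finite f a \<longleftrightarrow> integrable lborel (\<lambda>y. exp (a \<bullet> y) * f y)"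

(* f x is the conditional density of Y given X = x: the joint law of (X, Y) has density
   (x, y) |-> f x y with respect to the product of the law of X and Lebesgue measure. *)
definition has_cond_density ::
  "'w measure \<Rightarrow> ('w \<Rightarrow> real^2) \<Rightarrow> ('w \<Rightarrow> real^2) \<Rightarrow> (real^2 \<Rightarrow> real^2 \<Rightarrow> real) \<Rightarrow> bool" where
  "has_cond_density Pr X Y f \<longleftrightarrow>
     X \<in> borel_measurable Pr \<and>
     distributed Pr (distr Pr borel X \<Otimes>\<^sub>M lborel) (\<lambda>\<omega>. (X \<omega>, Y \<omega>))
       (\<lambda>(x, y). ennreal (f x y))"

(* Xm m and Xp m are the log-states before and after the intervention at time t_m. *)
definition increment_density ::
  "model \<Rightarrow> 'w measure \<Rightarrow> (nat \<Rightarrow> 'w \<Rightarrow> real^2) \<Rightarrow> (nat \<Rightarrow> 'w \<Rightarrow> real^2) \<Rightarrow> bool" where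
  "increment_density md Pr Xm Xp \<longleftrightarrow>
     dens md \<in> borel_measurable borel \<and> (\<forall>y. 0 \<le> dens md y) \<and>
     (\<forall>m<num_steps md.
        distributed Pr lborel (\<lambda>\<omega>. Xm (Suc m) \<omega> - Xp m \<omega>) (\<lambda>y. ennreal (dens md y)))"

definition assumption_A1 ::
  "model \<Rightarrow> 'w measure \<Rightarrow> (nat \<Rightarrow> 'w \<Rightarrow> real^2) \<Rightarrow> (nat \<Rightarrow> 'w \<Rightarrow> real^2) \<Rightarrow> bool" where
  "assumption_A1 md Pr Xm Xp \<longleftrightarrow>
     (\<forall>m<num_steps md. has_cond_density Pr (Xp m) (Xm (Suc m)) (\<lambda>x y. dens md (y - x)))"

definition assumption_A2 :: "model \<Rightarrow> bool" where
  "assumption_A2 md \<longleftrightarrow>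
     integrable lborel (dens md) \<and> (\<exists>B. AE y in lborel. \<bar>dens md y\<bar> \<le> B)"

definition assumption_A4 :: "model \<Rightarrow> bool" where
  "assumption_A4 md \<longleftrightarrow>
     (\<exists>\<alpha>' c\<^sub>0 R. 0 < \<alpha>' \<and> \<alpha>' \<le> 2 \<and> 0 < c\<^sub>0 \<and> 0 \<le> R \<and>
        (\<forall>\<eta>. norm \<eta> \<ge> R \<longrightarrow>
           cmod (char_fun (dens md) \<eta>) \<le> exp (- c\<^sub>0 * time_step md * norm \<eta> powr \<alpha>')))"

definition assumption_A5 :: "model \<Rightarrow> bool" where
  "assumption_A5 md \<longleftrightarrow>
     exp_moment_finite (dens md) (vector [1, 0]) \<and>
     exp_moment_finite (dens md) (vector [0, 1]) \<and>
     exp_moment_finite (dens md) (vector [1, 1]) \<and>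
     char_fun (dens md) 0 = 1"

definition rect :: "real set \<Rightarrow> real set \<Rightarrow> (real^2) set" where
  "rect A B = {x. x $ 1 \<in> A \<and> x $ 2 \<in> B}"

definition ext_lo :: "real \<Rightarrow> real \<Rightarrow> real" where
  "ext_lo zmin zmax = zmin - (zmax - zmin) / 2"

definition ext_hi :: "real \<Rightarrow> real \<Rightarrow> real" where
  "ext_hi zmin zmax = zmax + (zmax - zmin) / 2"

abbreviation "smin_ext md \<equiv> ext_lo (smin md) (smax md)"
abbreviation "smax_ext md \<equiv> ext_hi (smin md) (smax md)"
abbreviation "bmin_ext md \<equiv> ext_lo (bmin md) (bmax md)"
abbreviation "bmax_ext md \<equiv> ext_hi (bmin md) (bmax md)"

definition Omega :: "model \<Rightarrow> (real^2) set" where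
  "Omega md = rect {smin_ext md..smax_ext md} {bmin_ext md..bmax_ext md}"

definition Omega_in :: "model \<Rightarrow> (real^2) set" where
  "Omega_in md = rect {smin md<..<smax md} {bmin md<..<bmax md}"

definition Omega_smax :: "model \<Rightarrow> (real^2) set" where
  "Omega_smax md = rect {smax md..smax_ext md} {bmin_ext md..<bmax md}"

definition Omega_bmax :: "model \<Rightarrow> (real^2) set" where
  "Omega_bmax md = rect {smin_ext md..<smax md} {bmax md..bmax_ext md}"

definition Omega_smax_bmax :: "model \<Rightarrow> (real^2) set" where
  "Omega_smax_bmax md = rect {smax md..smax_ext md} {bmax md..bmax_ext md}"

(* Only used on Omega - Omega_in. *)
definition growth_dir :: "model \<Rightarrow> real^2 \<Rightarrow> real^2" where
  "growth_dir md x =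
     (if x \<in> Omega_smax md then vector [1, 0]
      else if x \<in> Omega_bmax md then vector [0, 1]
      else if x \<in> Omega_smax_bmax md then vector [1, 1]
      else vector [0, 0])"

definition wealth :: "real^2 \<Rightarrow> real" where
  "wealth x = exp (x $ 1) + exp (x $ 2)"

definition payoff :: "model \<Rightarrow> real^2 \<Rightarrow> real \<Rightarrow> real" where
  "payoff md x w = wealth x + gam md * (w + (1 / conf md) * min (wealth x - w) 0)"

definition post_state :: "model \<Rightarrow> real^2 \<Rightarrow> real \<Rightarrow> real \<Rightarrow> real^2" where
  "post_state md x q u =
     vector [ln (max (u * (wealth x + q)) (exp (wfloor md))),
             ln (max ((1 - u) * (wealth x + q)) (exp (wfloor md)))]"

record component =
  weight :: real
  mu_s :: real
  mu_b :: real
  sig_s :: real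
  sig_b :: real
  corr :: real

record bounds =
  mu_bar :: real
  sigma_min :: real
  sigma_max :: real
  rho_bar :: real

definition kernel_bounds :: "bounds \<Rightarrow> bool" where
  "kernel_bounds kb \<longleftrightarrow> 0 < sigma_min kb \<and> 0 < rho_bar kb \<and> rho_bar kb < 1"

definition Theta :: "bounds \<Rightarrow> nat \<Rightarrow> component list set" where
  "Theta kb N = {\<theta>. length \<theta> = N \<and> sum_list (map weight \<theta>) = 1 \<and>
     (\<forall>c\<in>set \<theta>. 0 \<le> weight c \<and> \<bar>mu_s c\<bar> \<le> mu_bar kb \<and> \<bar>mu_b c\<bar> \<le> mu_bar kb \<and>
        sigma_min kb \<le> sig_s c \<and> sig_s c \<le> sigma_max kb \<and>
        sigma_min kb \<le> sig_b c \<and> sig_b c \<le> sigma_max kb \<and> \<bar>corr c\<bar> \<le> rho_bar kb)}"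

definition mean :: "component \<Rightarrow> real^2" where
  "mean c = vector [mu_s c, mu_b c]"

definition covmat :: "component \<Rightarrow> real^2^2" where
  "covmat c = vector [vector [sig_s c ^ 2, corr c * sig_s c * sig_b c],
                      vector [corr c * sig_s c * sig_b c, sig_b c ^ 2]]"

definition binormal_density :: "real^2 \<Rightarrow> real^2^2 \<Rightarrow> real^2 \<Rightarrow> real" where
  "binormal_density \<mu> \<Sigma> y =
     exp (- (1/2) * ((y - \<mu>) \<bullet> (matrix_inv \<Sigma> *v (y - \<mu>)))) / (2 * pi * sqrt (det \<Sigma>))"

definition g_hat :: "component list \<Rightarrow> real^2 \<Rightarrow> real" where
  "g_hat \<theta> y = (\<Sum>c\<leftarrow>\<theta>. weight c * binormal_density (mean c) (covmat c) y)"

definition G_hat :: "component list \<Rightarrow> real^2 \<Rightarrow> complex" where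
  "G_hat \<theta> \<eta> = (\<Sum>c\<leftarrow>\<theta>. complex_of_real (weight c) *
     exp (\<i> * complex_of_real (\<eta> \<bullet> mean c) - complex_of_real ((1/2) * (\<eta> \<bullet> (covmat c *v \<eta>)))))"

record training =
  eta_max :: real                          (* eta' *)
  num_nodes :: nat                         (* P *)
  node :: "nat \<Rightarrow> real^2"                   (* eta_p, p = 1..P *)
  num_comp :: nat                          (* N *)
  Theta_emp :: "component list set"
  theta_star :: "component list"

definition D_eta :: "training \<Rightarrow> (real^2) set" where
  "D_eta tr = cbox (vec (- eta_max tr)) (vec (eta_max tr))"

definition reg_P :: "model \<Rightarrow> training \<Rightarrow> component list \<Rightarrow> real" where
  "reg_P md tr \<theta> = 1 / real (num_nodes tr) *
     (\<Sum>p = 1..num_nodes tr.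
        \<bar>Re (char_fun (dens md) (node tr p) - G_hat \<theta> (node tr p))\<bar> +
        \<bar>Im (char_fun (dens md) (node tr p) - G_hat \<theta> (node tr p))\<bar>)"

definition loss_P :: "model \<Rightarrow> training \<Rightarrow> component list \<Rightarrow> real" where
  "loss_P md tr \<theta> = 1 / real (num_nodes tr) *
     (\<Sum>p = 1..num_nodes tr. (cmod (char_fun (dens md) (node tr p) - G_hat \<theta> (node tr p)))\<^sup>2) +
     reg_P md tr \<theta>"

definition delta_min :: "training \<Rightarrow> real" where
  "delta_min tr = Min {norm (node tr p - node tr q) | p q.
     p \<in> {1..num_nodes tr} \<and> q \<in> {1..num_nodes tr} \<and> p \<noteq> q}"

definition delta_max :: "training \<Rightarrow> real" where
  "delta_max tr = Max ((\<lambda>p. Min ((\<lambda>q. norm (node tr p - node tr q)) ` ({1..num_nodes tr} - {p})))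
     ` {1..num_nodes tr})"

(* At least two nodes, so that delta_min and delta_max are extrema of nonempty sets. *)
definition training_setup :: "model \<Rightarrow> bounds \<Rightarrow> training \<Rightarrow> bool" where
  "training_setup md kb tr \<longleftrightarrow>
     0 < eta_max tr \<and> 2 \<le> num_nodes tr \<and>
     (\<forall>p\<in>{1..num_nodes tr}. node tr p \<in> D_eta tr) \<and>
     Theta_emp tr \<subseteq> Theta kb (num_comp tr) \<and>
     is_arg_min (loss_P md tr) (\<lambda>\<theta>. \<theta> \<in> Theta_emp tr) (theta_star tr)"

(* The tail integrals are nonnegative Lebesgue integrals, so the bounds include finiteness.
   The last conjunct says that the supremum C' of the gradient norms, over D_eta and Theta, is
   bounded by a constant not depending on h. *)
definition sampling_training ::
  "model \<Rightarrow> bounds \<Rightarrow> real \<Rightarrow> (real \<Rightarrow> training) \<Rightarrow> bool" where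
  "sampling_training md kb \<kappa> trn \<longleftrightarrow>
     (\<exists>c\<^sub>1>0. \<exists>c\<^sub>2>0. \<exists>c\<^sub>3>0. \<exists>c\<^sub>P>0. \<exists>C\<^sub>0>0. \<exists>C\<^sub>1 C'. \<forall>h\<in>{0<..<1}.
        training_setup md kb (trn h) \<and>
        (\<forall>p\<in>{1, 2}. \<forall>f\<in>{char_fun (dens md), G_hat (theta_star (trn h))}.
           (\<integral>\<^sup>+ \<eta>\<in>- D_eta (trn h). ennreal (cmod (f \<eta>) ^ p) \<partial>lborel)
             \<le> ennreal (c\<^sub>1 * h powr (1 + \<kappa>))) \<and>
        loss_P md (trn h) (theta_star (trn h)) \<le> c\<^sub>2 * h powr (1 + \<kappa>) \<and>
        reg_P md (trn h) (theta_star (trn h)) \<le> c\<^sub>3 * h powr (1 + \<kappa>) \<and>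
        c\<^sub>P * h powr (- 2 * (1 + \<kappa>)) \<le> real (num_nodes (trn h)) \<and>
        C\<^sub>0 * real (num_nodes (trn h)) powr (- (1/2)) \<le> delta_min (trn h) \<and>
        delta_min (trn h) \<le> delta_max (trn h) \<and>
        delta_max (trn h) \<le> C\<^sub>1 * real (num_nodes (trn h)) powr (- (1/2)) \<and>
        (\<forall>\<eta>\<in>D_eta (trn h). \<forall>\<theta>\<in>Theta kb (num_comp (trn h)). \<exists>D.
           GDERIV (\<lambda>\<eta>. (cmod (char_fun (dens md) \<eta> - G_hat \<theta> \<eta>))\<^sup>2) \<eta> :> D \<and> norm D \<le> C'))"

record mesh =
  Ns :: nat
  Nb :: nat
  Nu :: nat
  Nw :: nat

definition ds :: "model \<Rightarrow> mesh \<Rightarrow> real" where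
  "ds md ms = (smax md - smin md) / real (Ns ms)"

definition db :: "model \<Rightarrow> mesh \<Rightarrow> real" where
  "db md ms = (bmax md - bmin md) / real (Nb ms)"

definition du :: "mesh \<Rightarrow> real" where
  "du ms = 1 / real (Nu ms)"

definition dw :: "model \<Rightarrow> mesh \<Rightarrow> real" where
  "dw md ms = wmax md / real (Nw ms)"

definition mesh_scaling ::
  "model \<Rightarrow> real \<Rightarrow> real \<Rightarrow> real \<Rightarrow> real \<Rightarrow> real \<Rightarrow> mesh \<Rightarrow> bool" where
  "mesh_scaling md K\<^sub>1 K\<^sub>2 K\<^sub>3 K\<^sub>4 h ms \<longleftrightarrow>
     0 < Ns ms \<and> 0 < Nb ms \<and> 0 < Nu ms \<and> 0 < Nw ms \<and> even (Ns ms) \<and> even (Nb ms) \<and>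
     ds md ms = K\<^sub>1 * h \<and> db md ms = K\<^sub>2 * h \<and> du ms = K\<^sub>3 * h \<and> dw md ms = K\<^sub>4 * h"

definition s_mid :: "model \<Rightarrow> real" where
  "s_mid md = (smin_ext md + smax_ext md) / 2"

definition b_mid :: "model \<Rightarrow> real" where
  "b_mid md = (bmin_ext md + bmax_ext md) / 2"

definition s_node :: "model \<Rightarrow> mesh \<Rightarrow> int \<Rightarrow> real" where
  "s_node md ms k = s_mid md + of_int k * ds md ms"

definition b_node :: "model \<Rightarrow> mesh \<Rightarrow> int \<Rightarrow> real" where
  "b_node md ms j = b_mid md + of_int j * db md ms"

definition x_node :: "model \<Rightarrow> mesh \<Rightarrow> int \<Rightarrow> int \<Rightarrow> real^2" where
  "x_node md ms k j = vector [s_node md ms k, b_node md ms j]"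

definition s_idx :: "mesh \<Rightarrow> int set" where
  "s_idx ms = {- int (Ns ms)..int (Ns ms)}"

definition b_idx :: "mesh \<Rightarrow> int set" where
  "b_idx ms = {- int (Nb ms)..int (Nb ms)}"

definition control_grid :: "mesh \<Rightarrow> real set" where
  "control_grid ms = (\<lambda>i. real i * du ms) ` {0..Nu ms}"

definition threshold_grid :: "model \<Rightarrow> mesh \<Rightarrow> real set" where
  "threshold_grid md ms = (\<lambda>i. real i * dw md ms) ` {0..Nw ms}"

definition post_states_in_Omega :: "model \<Rightarrow> mesh \<Rightarrow> bool" where
  "post_states_in_Omega md ms \<longleftrightarrow>
     (\<forall>m<num_steps md. \<forall>k\<in>s_idx ms. \<forall>j\<in>b_idx ms. \<forall>u\<in>control_grid ms.
        x_node md ms k j \<in> Omega_in md \<longrightarrow>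
        post_state md (x_node md ms k j) (cash md m) u \<in> Omega md)"

definition trap_weight1 :: "nat \<Rightarrow> int \<Rightarrow> real" where
  "trap_weight1 N l = (if \<bar>l\<bar> = int N then 1/2 else 1)"

definition trap_weight :: "mesh \<Rightarrow> int \<Rightarrow> int \<Rightarrow> real" where
  "trap_weight ms l d = trap_weight1 (Ns ms) l * trap_weight1 (Nb ms) d"

(* Index of the left end point of the grid cell containing z; the last cell is closed. *)
definition cell_index :: "real \<Rightarrow> real \<Rightarrow> nat \<Rightarrow> real \<Rightarrow> int" where
  "cell_index zmid dz N z = min (int N - 1) \<lfloor>(z - zmid) / dz\<rfloor>"

definition bilinear :: "model \<Rightarrow> mesh \<Rightarrow> (int \<Rightarrow> int \<Rightarrow> real) \<Rightarrow> real^2 \<Rightarrow> real" where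
  "bilinear md ms v x =
     (let k = cell_index (s_mid md) (ds md ms) (Ns ms) (x $ 1);
          j = cell_index (b_mid md) (db md ms) (Nb ms) (x $ 2);
          \<xi> = (x $ 1 - s_node md ms k) / ds md ms;
          \<zeta> = (x $ 2 - b_node md ms j) / db md ms
      in (1 - \<xi>) * (1 - \<zeta>) * v k j + \<xi> * (1 - \<zeta>) * v (k + 1) j +
         (1 - \<xi>) * \<zeta> * v k (j + 1) + \<xi> * \<zeta> * v (k + 1) (j + 1))"

(* V^{m,+} from V^{m+1,-} *)
definition time_advance ::
  "model \<Rightarrow> mesh \<Rightarrow> (real^2 \<Rightarrow> real) \<Rightarrow> (int \<Rightarrow> int \<Rightarrow> real) \<Rightarrow> int \<Rightarrow> int \<Rightarrow> real" where
  "time_advance md ms gh v k j =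
     (if x_node md ms k j \<in> Omega_in md
      then ds md ms * db md ms *
        (\<Sum>l\<in>s_idx ms. \<Sum>d\<in>b_idx ms. trap_weight ms l d *
           gh (vector [s_node md ms l - s_node md ms k, b_node md ms d - b_node md ms j]) * v l d)
      else exp_moment (dens md) (growth_dir md (x_node md ms k j)) * v k j)"

(* V^{m,-} from V^{m,+}, with q = q_m *)
definition intervene ::
  "model \<Rightarrow> mesh \<Rightarrow> real \<Rightarrow> (int \<Rightarrow> int \<Rightarrow> real) \<Rightarrow> int \<Rightarrow> int \<Rightarrow> real" where
  "intervene md ms q v k j =
     (if x_node md ms k j \<in> Omega_in md
      then Max ((\<lambda>u. bilinear md ms v (post_state md (x_node md ms k j) q u)) ` control_grid ms)
      else v k j)"

(* backward_value n is the solution n steps before maturity, i.e. V^{M-n,-}. *)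
primrec backward_value ::
  "model \<Rightarrow> mesh \<Rightarrow> (real^2 \<Rightarrow> real) \<Rightarrow> real \<Rightarrow> nat \<Rightarrow> int \<Rightarrow> int \<Rightarrow> real" where
  "backward_value md ms gh w 0 = (\<lambda>k j. payoff md (x_node md ms k j) w)"
| "backward_value md ms gh w (Suc n) =
     intervene md ms (cash md (num_steps md - Suc n))
       (time_advance md ms gh (backward_value md ms gh w n))"

definition V_minus ::
  "model \<Rightarrow> mesh \<Rightarrow> (real^2 \<Rightarrow> real) \<Rightarrow> real \<Rightarrow> nat \<Rightarrow> int \<Rightarrow> int \<Rightarrow> real" where
  "V_minus md ms gh w m = backward_value md ms gh w (num_steps md - m)"

definition linf_norm :: "mesh \<Rightarrow> (int \<Rightarrow> int \<Rightarrow> real) \<Rightarrow> real" where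
  "linf_norm ms v = Max ((\<lambda>(k, j). \<bar>v k j\<bar>) ` (s_idx ms \<times> b_idx ms))"

end

theory Submission
  imports Defs
begin

text \<open>
  Because the number of time steps is fixed, it suffices that every step amplifies the maximum norm
  by at most a factor that does not depend on the mesh. The intervention step is a maximum of
  convex combinations of nodal values, and the boundary step multiplies by one of four fixed
  numbers. For the quadrature step, the bounds on the standard deviations and the correlations keep
  the determinants of the covariance matrices away from zero, so the kernel is bounded by a
  constant; and the quadrature rule has total weight at most nine times the area of the inner
  domain.
\<close>

definition bounded_nodal :: "mesh \<Rightarrow> real \<Rightarrow> (int \<Rightarrow> int \<Rightarrow> real) \<Rightarrow> bool" where
  "bounded_nodal ms B v \<longleftrightarrow> (\<forall>k\<in>s_idx ms. \<forall>j\<in>b_idx ms. \<bar>v k j\<bar> \<le> B)"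

lemma linf_norm_le:
  assumes "bounded_nodal ms B v"
  shows "linf_norm ms v \<le> B"
  using assms unfolding linf_norm_def bounded_nodal_def
  by (subst Max_le_iff) (auto simp: s_idx_def b_idx_def)

section \<open>Uniform bounds for the Gaussian mixture kernel\<close>

lemma det_covmat:
  "det (covmat c) = (sig_s c)\<^sup>2 * (sig_b c)\<^sup>2 * (1 - (corr c)\<^sup>2)"
  by (simp add: covmat_def det_2 power2_eq_square algebra_simps)

text \<open>Completing the square in \<open>w $ 1\<close> leaves a remainder with the factor
  \<open>1 - (corr c)^2\<close>.\<close>

lemma covmat_quadratic_form_nonneg:
  assumes "\<bar>corr c\<bar> \<le> 1"
  shows "0 \<le> w \<bullet> (covmat c *v w)"
proof -
  have "w \<bullet> (covmat c *v w) =
      w $ 1 * ((sig_s c)\<^sup>2 * w $ 1 + corr c * sig_s c * sig_b c * w $ 2) +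
      w $ 2 * (corr c * sig_s c * sig_b c * w $ 1 + (sig_b c)\<^sup>2 * w $ 2)"
    by (simp add: covmat_def inner_vec_def matrix_vector_mult_def sum_2)
  also have "\<dots> =
      (sig_s c * w $ 1 + corr c * sig_b c * w $ 2)\<^sup>2 + (1 - (corr c)\<^sup>2) * (sig_b c * w $ 2)\<^sup>2"
    by (simp add: power2_eq_square algebra_simps)
  also have "\<dots> \<ge> 0"
    using assms by (simp add: abs_square_le_1)
  finally show ?thesis .
qed

text \<open>Writing \<open>z\<close> as \<open>A\<close> applied to \<open>matrix_inv A *v z\<close>
  turns the form of the inverse into the form of \<open>A\<close>. This gives the sign of the
  Gaussian exponent without computing the inverse.\<close>

lemma inner_matrix_inv_nonneg:
  fixes A :: "real^'n^'n"
  assumes "invertible A" and "\<And>w. 0 \<le> w \<bullet> (A *v w)"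
  shows "0 \<le> z \<bullet> (matrix_inv A *v z)"
proof -
  have "A ** matrix_inv A = mat 1"
    using assms(1) unfolding invertible_def matrix_inv_def by (rule someI2_ex) simp
  then have "z = A *v (matrix_inv A *v z)"
    by (simp add: matrix_vector_mul_assoc)
  then show ?thesis
    using assms(2)[of "matrix_inv A *v z"] by (metis inner_commute)
qed

text \<open>The peak height of a bivariate normal density whose covariance matrix has the smallest
  determinant that the bounds allow: both deviations equal to \<open>sigma_min\<close>, correlation
  \<open>rho_bar\<close> in absolute value.\<close>

definition kernel_sup :: "bounds \<Rightarrow> real" where
  "kernel_sup kb = 1 / (2 * pi * sqrt (sigma_min kb ^ 4 * (1 - (rho_bar kb)\<^sup>2)))"

lemma binormal_density_bounds:
  assumes "kernel_bounds kb" "sigma_min kb \<le> sig_s c" "sigma_min kb \<le> sig_b c"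
    "\<bar>corr c\<bar> \<le> rho_bar kb"
  shows "0 \<le> binormal_density (mean c) (covmat c) y"
    and "binormal_density (mean c) (covmat c) y \<le> kernel_sup kb"
proof -
  let ?d = "sigma_min kb ^ 4 * (1 - (rho_bar kb)\<^sup>2)"
  have kb: "0 < sigma_min kb" "0 < rho_bar kb" "rho_bar kb < 1"
    using assms(1) by (auto simp: kernel_bounds_def)
  have "(rho_bar kb)\<^sup>2 < 1"
    using kb by (simp add: abs_square_less_1)
  then have d_pos: "0 < ?d"
    using kb by simp
  have "(corr c)\<^sup>2 \<le> (rho_bar kb)\<^sup>2"
    using assms(4) kb by (simp add: abs_le_square_iff[symmetric])
  moreover have "sigma_min kb ^ 4 \<le> (sig_s c)\<^sup>2 * (sig_b c)\<^sup>2"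
  proof -
    have "(sigma_min kb)\<^sup>2 * (sigma_min kb)\<^sup>2 \<le> (sig_s c)\<^sup>2 * (sig_b c)\<^sup>2"
      using assms kb by (intro mult_mono power_mono) auto
    then show ?thesis
      by (simp add: power_add[symmetric])
  qed
  ultimately have det_ge: "?d \<le> det (covmat c)"
    unfolding det_covmat using \<open>(rho_bar kb)\<^sup>2 < 1\<close> by (intro mult_mono) auto
  then have det_pos: "0 < det (covmat c)"
    using d_pos by linarith
  then have "invertible (covmat c)"
    by (simp add: invertible_det_nz)
  moreover have "\<bar>corr c\<bar> \<le> 1"
    using assms(4) kb by linarith
  ultimately have form: "0 \<le> z \<bullet> (matrix_inv (covmat c) *v z)" for z
    by (intro inner_matrix_inv_nonneg covmat_quadratic_form_nonneg)
  show "0 \<le> binormal_density (mean c) (covmat c) y"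
    using det_pos by (simp add: binormal_density_def)
  show "binormal_density (mean c) (covmat c) y \<le> kernel_sup kb"
    \<comment> \<open>The numerator is at most 1, since \<open>form\<close> makes the exponent
      nonpositive; the denominator is bounded below through \<open>det_ge\<close>.\<close>
    unfolding binormal_density_def kernel_sup_def
    using form[of "y - mean c"] det_ge d_pos
    by (intro frac_le mult_left_mono real_sqrt_le_mono) auto
qed

text \<open>The weights are nonnegative and sum to one, so the mixture inherits the bounds of its
  components. The upper bound depends on \<open>kb\<close> alone, hence neither on the number of
  components nor on the trained parameters.\<close>

lemma g_hat_bounds:
  assumes "kernel_bounds kb" "\<theta> \<in> Theta kb N"
  shows "0 \<le> g_hat \<theta> y" and "g_hat \<theta> y \<le> kernel_sup kb"
proof -
  have comp: "0 \<le> weight c" "0 \<le> binormal_density (mean c) (covmat c) y"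
    "binormal_density (mean c) (covmat c) y \<le> kernel_sup kb" if "c \<in> set \<theta>" for c
    using assms(2) that binormal_density_bounds[OF assms(1), of c y] by (auto simp: Theta_def)
  show "0 \<le> g_hat \<theta> y"
    unfolding g_hat_def using comp by (intro sum_list_nonneg) auto
  have "g_hat \<theta> y \<le> (\<Sum>c\<leftarrow>\<theta>. weight c * kernel_sup kb)"
    unfolding g_hat_def using comp by (intro sum_list_mono mult_left_mono) auto
  also have "\<dots> = kernel_sup kb"
    using assms(2) by (simp add: sum_list_mult_const Theta_def)
  finally show "g_hat \<theta> y \<le> kernel_sup kb" .
qed

section \<open>Grid cells and bilinear interpolation\<close>

lemma cell_index_bounds:
  fixes zmid dz z :: real and N :: nat
  assumes "0 < dz" "0 < N" "zmid - real N * dz \<le> z" "z \<le> zmid + real N * dz"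
  defines "k \<equiv> cell_index zmid dz N z"
  shows "- int N \<le> k" "k + 1 \<le> int N"
    "0 \<le> (z - (zmid + of_int k * dz)) / dz" "(z - (zmid + of_int k * dz)) / dz \<le> 1"
proof -
  let ?t = "(z - zmid) / dz"
  have t: "- real N \<le> ?t" "?t \<le> real N"
    using assms by (auto simp: field_simps)
  have eq: "(z - (zmid + of_int k * dz)) / dz = ?t - of_int k"
    using assms(1) by (simp add: field_simps)
  have k: "k = min (int N - 1) \<lfloor>?t\<rfloor>"
    by (simp add: k_def cell_index_def)
  show "- int N \<le> k"
    using t assms(2) by (auto simp: k le_floor_iff)
  show "k + 1 \<le> int N"
    by (simp add: k)
  \<comment> \<open>If the cap \<open>int N - 1\<close> is active, the upper bound comes from
    \<open>?t \<le> real N\<close>, so the right end point falls into the closed last cell;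
    otherwise \<open>k\<close> is the floor of \<open>?t\<close>.\<close>
  have "of_int k \<le> ?t \<and> ?t \<le> of_int k + 1"
    unfolding k using t(2) by (cases "int N - 1 \<le> \<lfloor>?t\<rfloor>") (auto simp: min_def, linarith+)
  then show "0 \<le> (z - (zmid + of_int k * dz)) / dz" "(z - (zmid + of_int k * dz)) / dz \<le> 1"
    unfolding eq by auto
qed

lemma abs_convex_comb_le:
  fixes a b t B :: real
  assumes "0 \<le> t" "t \<le> 1" "\<bar>a\<bar> \<le> B" "\<bar>b\<bar> \<le> B"
  shows "\<bar>(1 - t) * a + t * b\<bar> \<le> B"
proof -
  have "\<bar>(1 - t) * a + t * b\<bar> \<le> (1 - t) * \<bar>a\<bar> + t * \<bar>b\<bar>"
    using abs_triangle_ineq[of "(1 - t) * a" "t * b"] assms by (simp add: abs_mult)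
  also have "\<dots> \<le> B"
    using assms by (intro convex_bound_le) auto
  finally show ?thesis .
qed

locale uniform_mesh =
  fixes md :: model and ms :: mesh
  assumes model: "model_data md" and Ns_pos: "0 < Ns ms" and Nb_pos: "0 < Nb ms"
begin

lemma ds_pos: "0 < ds md ms" and db_pos: "0 < db md ms"
  using model Ns_pos Nb_pos by (auto simp: ds_def db_def model_data_def)

lemma Ns_ds: "real (Ns ms) * ds md ms = smax md - smin md"
  and Nb_db: "real (Nb ms) * db md ms = bmax md - bmin md"
  using Ns_pos Nb_pos by (auto simp: ds_def db_def)

text \<open>Extending by half a width on each side doubles the width, so exactly
  \<open>Ns ms\<close> or \<open>Nb ms\<close> cells lie on either side of the midpoint.\<close>

lemma Omega_eq:
  "Omega md = rect
     {s_mid md - real (Ns ms) * ds md ms..s_mid md + real (Ns ms) * ds md ms}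
     {b_mid md - real (Nb ms) * db md ms..b_mid md + real (Nb ms) * db md ms}"
  unfolding Ns_ds Nb_db Omega_def s_mid_def b_mid_def ext_lo_def ext_hi_def
  by (intro arg_cong2[where f = rect] arg_cong2[where f = atLeastAtMost])
     (simp_all add: field_simps)

lemma x_node_in_Omega:
  assumes "k \<in> s_idx ms" "j \<in> b_idx ms"
  shows "x_node md ms k j \<in> Omega md"
proof -
  have "\<bar>of_int i * d\<bar> \<le> real N * d" if "0 < d" "i \<in> {- int N..int N}" for i d N
  proof -
    have "\<bar>real_of_int i\<bar> \<le> real N"
      using that(2) by auto
    then show ?thesis
      using that(1) by (simp add: abs_mult)
  qed
  from this[OF ds_pos, of k "Ns ms"] this[OF db_pos, of j "Nb ms"] assms show ?thesis
    by (auto simp: Omega_eq rect_def x_node_def s_node_def b_node_def s_idx_def b_idx_def)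
qed

text \<open>Interpolating in \<open>s\<close> along two edges of the cell and then in
  \<open>b\<close> between the results amounts to three convex combinations, none of which enlarges
  the bound.\<close>

lemma abs_bilinear_le:
  assumes v: "bounded_nodal ms B v" and x: "x \<in> Omega md"
  shows "\<bar>bilinear md ms v x\<bar> \<le> B"
proof -
  define k where "k = cell_index (s_mid md) (ds md ms) (Ns ms) (x $ 1)"
  define j where "j = cell_index (b_mid md) (db md ms) (Nb ms) (x $ 2)"
  define \<xi> where "\<xi> = (x $ 1 - s_node md ms k) / ds md ms"
  define \<zeta> where "\<zeta> = (x $ 2 - b_node md ms j) / db md ms"
  have k: "- int (Ns ms) \<le> k" "k + 1 \<le> int (Ns ms)" and \<xi>: "0 \<le> \<xi>" "\<xi> \<le> 1"
    using x cell_index_bounds[OF ds_pos Ns_pos, of "s_mid md" "x $ 1"]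
    by (auto simp: k_def \<xi>_def s_node_def Omega_eq rect_def)
  have j: "- int (Nb ms) \<le> j" "j + 1 \<le> int (Nb ms)" and \<zeta>: "0 \<le> \<zeta>" "\<zeta> \<le> 1"
    using x cell_index_bounds[OF db_pos Nb_pos, of "b_mid md" "x $ 2"]
    by (auto simp: j_def \<zeta>_def b_node_def Omega_eq rect_def)
  have idx: "k \<in> s_idx ms" "k + 1 \<in> s_idx ms" "j \<in> b_idx ms" "j + 1 \<in> b_idx ms"
    using k j by (auto simp: s_idx_def b_idx_def)
  have "bilinear md ms v x =
      (1 - \<zeta>) * ((1 - \<xi>) * v k j + \<xi> * v (k + 1) j) +
      \<zeta> * ((1 - \<xi>) * v k (j + 1) + \<xi> * v (k + 1) (j + 1))"
    unfolding bilinear_def Let_def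
    by (fold k_def j_def, fold \<xi>_def \<zeta>_def) (simp add: algebra_simps)
  also have "\<bar>\<dots>\<bar> \<le> B"
    using v idx unfolding bounded_nodal_def by (intro abs_convex_comb_le \<xi> \<zeta>) auto
  finally show ?thesis .
qed

section \<open>Growth of the maximum norm in one time step\<close>

lemma bounded_nodal_intervene:
  assumes v: "bounded_nodal ms B v"
    and post: "\<And>k j u. k \<in> s_idx ms \<Longrightarrow> j \<in> b_idx ms \<Longrightarrow> u \<in> control_grid ms \<Longrightarrow>
      x_node md ms k j \<in> Omega_in md \<Longrightarrow> post_state md (x_node md ms k j) q u \<in> Omega md"
  shows "bounded_nodal ms B (intervene md ms q v)"
proof -
  have "\<bar>intervene md ms q v k j\<bar> \<le> B" if kj: "k \<in> s_idx ms" "j \<in> b_idx ms" for k j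
  proof (cases "x_node md ms k j \<in> Omega_in md")
    case True
    let ?S = "(\<lambda>u. bilinear md ms v (post_state md (x_node md ms k j) q u)) ` control_grid ms"
    \<comment> \<open>An attained maximum is itself an interpolated value, which bounds it from
      above and below at once.\<close>
    have "Max ?S \<in> ?S"
      by (intro Max_in) (auto simp: control_grid_def)
    then show ?thesis
      using True abs_bilinear_le[OF v post[OF kj]] by (auto simp: intervene_def)
  next
    case False
    then show ?thesis
      using v kj by (simp add: intervene_def bounded_nodal_def)
  qed
  then show ?thesis
    by (simp add: bounded_nodal_def)
qed

lemma quadrature_weight_bound:
  "ds md ms * db md ms * (\<Sum>l\<in>s_idx ms. \<Sum>d\<in>b_idx ms. trap_weight ms l d)
     \<le> 9 * (smax md - smin md) * (bmax md - bmin md)"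
proof -
  have "(\<Sum>l\<in>s_idx ms. \<Sum>d\<in>b_idx ms. trap_weight ms l d) \<le> (\<Sum>l\<in>s_idx ms. \<Sum>d\<in>b_idx ms. 1)"
    by (intro sum_mono) (auto simp: trap_weight_def trap_weight1_def)
  also have "\<dots> = (2 * real (Ns ms) + 1) * (2 * real (Nb ms) + 1)"
    by (simp add: s_idx_def b_idx_def algebra_simps)
  \<comment> \<open>\<open>2 * n + 1 \<le> 3 * n\<close> for \<open>n \<ge> 1\<close> replaces the
    node counts by multiples of the cell counts, which cancel against the spacings; this is the
    origin of the factor 9.\<close>
  also have "\<dots> \<le> (3 * real (Ns ms)) * (3 * real (Nb ms))"
    using Ns_pos Nb_pos by (intro mult_mono) auto
  finally have "ds md ms * db md ms * (\<Sum>l\<in>s_idx ms. \<Sum>d\<in>b_idx ms. trap_weight ms l d)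
      \<le> ds md ms * db md ms * ((3 * real (Ns ms)) * (3 * real (Nb ms)))"
    using ds_pos db_pos by (intro mult_left_mono) auto
  also have "\<dots> = 9 * (real (Ns ms) * ds md ms) * (real (Nb ms) * db md ms)"
    by simp
  finally show ?thesis
    by (simp only: Ns_ds Nb_db)
qed

text \<open>\<open>A\<close> dominates both growth factors: the total quadrature weight times the
  kernel bound at inner nodes, and the exponential moment at boundary nodes.\<close>

lemma bounded_nodal_time_advance:
  assumes v: "bounded_nodal ms B v" and B: "0 \<le> B"
    and gh: "\<And>y. 0 \<le> gh y" "\<And>y. gh y \<le> S"
    and quad: "9 * (smax md - smin md) * (bmax md - bmin md) * S \<le> A"
    and bdry: "\<And>x. \<bar>exp_moment (dens md) (growth_dir md x)\<bar> \<le> A"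
  shows "bounded_nodal ms (A * B) (time_advance md ms gh v)"
proof -
  have "\<bar>time_advance md ms gh v k j\<bar> \<le> A * B" if kj: "k \<in> s_idx ms" "j \<in> b_idx ms" for k j
  proof (cases "x_node md ms k j \<in> Omega_in md")
    case True
    let ?y = "\<lambda>l d. vector [s_node md ms l - s_node md ms k, b_node md ms d - b_node md ms j]"
    let ?W = "\<Sum>l\<in>s_idx ms. \<Sum>d\<in>b_idx ms. trap_weight ms l d"
    have S: "0 \<le> S"
      using gh order_trans by blast
    have "\<bar>\<Sum>l\<in>s_idx ms. \<Sum>d\<in>b_idx ms. trap_weight ms l d * gh (?y l d) * v l d\<bar>
        \<le> (\<Sum>l\<in>s_idx ms. \<Sum>d\<in>b_idx ms. \<bar>trap_weight ms l d * gh (?y l d) * v l d\<bar>)"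
      by (intro order_trans[OF sum_abs] sum_mono) simp
    also have "\<dots> \<le> (\<Sum>l\<in>s_idx ms. \<Sum>d\<in>b_idx ms. trap_weight ms l d * S * B)"
      using v S gh unfolding bounded_nodal_def abs_mult
      by (intro sum_mono mult_mono) (auto simp: trap_weight_def trap_weight1_def)
    also have "\<dots> = ?W * S * B"
      by (simp add: sum_distrib_right)
    finally have "\<bar>time_advance md ms gh v k j\<bar> \<le> ds md ms * db md ms * (?W * S * B)"
      using True ds_pos db_pos by (simp add: time_advance_def abs_mult)
    also have "\<dots> = ds md ms * db md ms * ?W * S * B"
      by (simp add: mult.assoc)
    also have "\<dots> \<le> 9 * (smax md - smin md) * (bmax md - bmin md) * S * B"
      using quadrature_weight_bound S B by (intro mult_right_mono)
    also have "\<dots> \<le> A * B"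
      using quad B by (intro mult_right_mono)
    finally show ?thesis .
  next
    case False
    have "\<bar>exp_moment (dens md) (growth_dir md (x_node md ms k j))\<bar> * \<bar>v k j\<bar> \<le> A * B"
      using v kj bdry order_trans[OF abs_ge_zero bdry]
      by (intro mult_mono) (auto simp: bounded_nodal_def)
    then show ?thesis
      using False by (simp add: time_advance_def abs_mult)
  qed
  then show ?thesis
    by (simp add: bounded_nodal_def)
qed

end

section \<open>Bound for the terminal payoff\<close>

definition payoff_sup :: "model \<Rightarrow> real \<Rightarrow> real" where
  "payoff_sup md w = (let W = exp (smax_ext md) + exp (bmax_ext md)
     in W + gam md * (\<bar>w\<bar> + 1 / conf md * (W + \<bar>w\<bar>)))"

text \<open>Wealth increases in both coordinates, so its value at the upper corner of
  \<open>Omega md\<close> dominates it; the shortfall term is then controlled by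
  \<open>W + \<bar>w\<bar>\<close>.\<close>

lemma abs_payoff_le:
  assumes "model_data md" "x \<in> Omega md"
  shows "\<bar>payoff md x w\<bar> \<le> payoff_sup md w"
proof -
  let ?W = "exp (smax_ext md) + exp (bmax_ext md)"
  have pos: "0 < gam md" "0 < conf md"
    using assms(1) by (auto simp: model_data_def)
  have wealth: "0 \<le> wealth x" "wealth x \<le> ?W"
    using assms(2) by (auto simp: wealth_def Omega_def rect_def intro!: add_mono add_nonneg_nonneg)
  have "\<bar>1 / conf md * min (wealth x - w) 0\<bar> = 1 / conf md * \<bar>min (wealth x - w) 0\<bar>"
    using pos by (simp add: abs_mult)
  also have "\<dots> \<le> 1 / conf md * (?W + \<bar>w\<bar>)"
    using wealth pos by (intro mult_left_mono) auto
  finally have "\<bar>w + 1 / conf md * min (wealth x - w) 0\<bar> \<le> \<bar>w\<bar> + 1 / conf md * (?W + \<bar>w\<bar>)"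
    by linarith
  then have "\<bar>gam md * (w + 1 / conf md * min (wealth x - w) 0)\<bar>
      \<le> gam md * (\<bar>w\<bar> + 1 / conf md * (?W + \<bar>w\<bar>))"
    using pos by (simp only: abs_mult abs_of_pos mult_left_mono less_imp_le)
  then show ?thesis
    using wealth unfolding payoff_def payoff_sup_def Let_def by linarith
qed

lemma payoff_sup_pos:
  assumes "model_data md"
  shows "0 < payoff_sup md w"
  using assms unfolding payoff_sup_def Let_def model_data_def
  by (intro add_pos_nonneg mult_nonneg_nonneg add_nonneg_nonneg) auto

section \<open>Backward induction over the time steps\<close>

context uniform_mesh
begin

text \<open>Each step costs one factor \<open>A\<close>: the time advance contributes it, and the
  intervention preserves the resulting bound.\<close>

lemma bounded_nodal_backward_value:
  assumes gh: "\<And>y. 0 \<le> gh y" "\<And>y. gh y \<le> S"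
    and quad: "9 * (smax md - smin md) * (bmax md - bmin md) * S \<le> A"
    and bdry: "\<And>x. \<bar>exp_moment (dens md) (growth_dir md x)\<bar> \<le> A"
    and post: "post_states_in_Omega md ms"
    and "n \<le> num_steps md"
  shows "bounded_nodal ms (A ^ n * payoff_sup md w) (backward_value md ms gh w n)"
  using \<open>n \<le> num_steps md\<close>
proof (induction n)
  case 0
  then show ?case
    using abs_payoff_le[OF model x_node_in_Omega] by (simp add: bounded_nodal_def)
next
  case (Suc n)
  have "0 \<le> A"
    using bdry abs_ge_zero order_trans by blast
  then have "0 \<le> A ^ n * payoff_sup md w"
    using payoff_sup_pos[OF model, of w] by simp
  then have "bounded_nodal ms (A * (A ^ n * payoff_sup md w))
      (time_advance md ms gh (backward_value md ms gh w n))"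
    using Suc by (intro bounded_nodal_time_advance[OF _ _ gh quad bdry]) auto
  \<comment> \<open>Step \<open>Suc n\<close> before maturity uses the cash input at this time
    index, which must lie in the range covered by \<open>post\<close>.\<close>
  moreover have "num_steps md - Suc n < num_steps md"
    using Suc.prems by simp
  ultimately show ?case
    using post unfolding post_states_in_Omega_def
    by (auto simp: mult.assoc intro!: bounded_nodal_intervene)
qed

end

section \<open>Mesh-independent constants and stability\<close>

lemma exp_moment_growth_dir_bounded:
  fixes md :: model
  obtains E where "\<And>x. \<bar>exp_moment (dens md) (growth_dir md x)\<bar> \<le> E"
proof -
  \<comment> \<open>\<open>growth_dir md\<close> takes only these four values on the whole plane, so
    a finite maximum serves as the bound.\<close>
  let ?dirs = "{vector [1, 0], vector [0, 1], vector [1, 1], vector [0, 0]} :: (real^2) set"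
  have "\<bar>exp_moment (dens md) (growth_dir md x)\<bar> \<le> Max ((\<lambda>a. \<bar>exp_moment (dens md) a\<bar>) ` ?dirs)" for x
    by (intro Max_ge imageI) (auto simp: growth_dir_def)
  then show ?thesis
    using that by blast
qed

theorem lemma6p1:
  fixes md :: model and kb :: bounds and trn :: "real \<Rightarrow> training"
    and Pr :: "'w measure" and Xm Xp :: "nat \<Rightarrow> 'w \<Rightarrow> real^2"
    and \<kappa> K\<^sub>1 K\<^sub>2 K\<^sub>3 K\<^sub>4 w\<^sub>c :: real
  assumes "model_data md"
    and "prob_space Pr"
    and "increment_density md Pr Xm Xp"
    and "assumption_A1 md Pr Xm Xp"
    and "assumption_A2 md"
    and "assumption_A4 md"
    and "assumption_A5 md"
    and "kernel_bounds kb"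
    and "0 < \<kappa>" and "\<kappa> < 1"
    and "sampling_training md kb \<kappa> trn"
    and "0 < K\<^sub>1" and "0 < K\<^sub>2" and "0 < K\<^sub>3" and "0 < K\<^sub>4"
    and "\<And>h ms. h \<in> {0<..<1} \<Longrightarrow> mesh_scaling md K\<^sub>1 K\<^sub>2 K\<^sub>3 K\<^sub>4 h ms \<Longrightarrow>
           post_states_in_Omega md ms"
  shows "\<exists>h\<^sub>0>0. \<exists>C>0. \<forall>h ms.
           0 < h \<and> h \<le> h\<^sub>0 \<and> mesh_scaling md K\<^sub>1 K\<^sub>2 K\<^sub>3 K\<^sub>4 h ms \<and> w\<^sub>c \<in> threshold_grid md ms \<longrightarrow>
           (\<forall>m\<le>num_steps md.
              linf_norm ms (V_minus md ms (g_hat (theta_star (trn h))) w\<^sub>c m) \<le> C)"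
proof -
  obtain E where E: "\<And>x. \<bar>exp_moment (dens md) (growth_dir md x)\<bar> \<le> E"
    using exp_moment_growth_dir_bounded[of md] by blast
  \<comment> \<open>The entry 1 makes the powers of \<open>A\<close> increase with the exponent, so
    the bound after all time steps also covers every intermediate time.\<close>
  define A where
    "A = max 1 (max E (9 * (smax md - smin md) * (bmax md - bmin md) * kernel_sup kb))"
  \<comment> \<open>\<open>C\<close> is built from the model, the kernel bounds and the threshold,
    all fixed before \<open>h\<close>.\<close>
  define C where "C = A ^ num_steps md * payoff_sup md w\<^sub>c"
  have A: "1 \<le> A" "E \<le> A" "9 * (smax md - smin md) * (bmax md - bmin md) * kernel_sup kb \<le> A"
    by (auto simp: A_def)
  have P: "0 < payoff_sup md w\<^sub>c"
    using assms(1) by (rule payoff_sup_pos)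
  \<comment> \<open>The cutoff 1/2 keeps \<open>h\<close> inside the open unit interval on which the
    training assumptions hold.\<close>
  have "linf_norm ms (V_minus md ms (g_hat (theta_star (trn h))) w\<^sub>c m) \<le> C"
    if h: "0 < h" "h \<le> 1/2" and ms: "mesh_scaling md K\<^sub>1 K\<^sub>2 K\<^sub>3 K\<^sub>4 h ms" for h ms m
  proof -
    have h1: "h \<in> {0<..<1}"
      using h by simp
    interpret uniform_mesh md ms
      using assms(1) ms by unfold_locales (auto simp: mesh_scaling_def)
    have "training_setup md kb (trn h)"
      using assms(11) h1 unfolding sampling_training_def by blast
    \<comment> \<open>A minimizer over the empirical set belongs to that set and hence to
      \<open>Theta\<close>, so the kernel bounds apply to it.\<close>
    then have \<theta>: "theta_star (trn h) \<in> Theta kb (num_comp (trn h))"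
      by (auto simp: training_setup_def is_arg_min_def)
    have "bounded_nodal ms (A ^ (num_steps md - m) * payoff_sup md w\<^sub>c)
        (V_minus md ms (g_hat (theta_star (trn h))) w\<^sub>c m)"
      unfolding V_minus_def
      using g_hat_bounds[OF assms(8) \<theta>] A(3) order_trans[OF E A(2)] assms(16)[OF h1 ms]
      by (rule bounded_nodal_backward_value) simp
    from linf_norm_le[OF this]
    have "linf_norm ms (V_minus md ms (g_hat (theta_star (trn h))) w\<^sub>c m)
        \<le> A ^ (num_steps md - m) * payoff_sup md w\<^sub>c" .
    also have "\<dots> \<le> C"
      unfolding C_def using A(1) P by (intro mult_right_mono power_increasing) auto
    finally show ?thesis .
  qed
  moreover have "0 < C"
    using A(1) P by (simp add: C_def)
  ultimately show ?thesis
    by (intro exI[of _ "1/2"] exI[of _ C] conjI) auto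
qed

end
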